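(* Let $G$ be a torsion-free abelian group. Then $\mathcal{GP}(G)$ is complete if and only if $G$ is isomorphic to a subgroup of $\mathbb{Q}$, the additive group of rational numbers.
   Context: For a group $G$, the generalized power graph $\mathcal{GP}(G)$ is the simple undirected graph whose vertices are the non-identity elements of $G$, two distinct vertices $a,b$ being adjacent if and only if $\langle a\rangle\cap\langle b\rangle\neq 1$. A graph is complete if any two distinct vertices are adjacent; the graph with no vertices (the case of the trivial group) counts as complete. *)

theory Defs
  imports "HOL-Algebra.Algebra"
begin

text \<open>Undirected graphs without parallel edges, possibly infinite: an edge is the set of its two
  endpoints.\<close>

record 'v ugraph =
  vertices :: "'v set"
  edges :: "'v set set"

definition simple_graph :: "'v ugraph \<Rightarrow> bool" where
  "simple_graph \<Gamma> \<longleftrightarrow> (\<forall>e \<in> edges \<Gamma>. e \<subseteq> vertices \<Gamma> \<and> card e = 2)"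

definition complete_graph :: "'v ugraph \<Rightarrow> bool" where
  "complete_graph \<Gamma> \<longleftrightarrow>
     simple_graph \<Gamma> \<and> (\<forall>a \<in> vertices \<Gamma>. \<forall>b \<in> vertices \<Gamma>. a \<noteq> b \<longrightarrow> {a, b} \<in> edges \<Gamma>)"

definition generalized_power_graph :: "('a, 'b) monoid_scheme \<Rightarrow> 'a ugraph" where
  "generalized_power_graph G =
     \<lparr>vertices = carrier G - {\<one>\<^bsub>G\<^esub>},
      edges = {{a, b} | a b. a \<in> carrier G - {\<one>\<^bsub>G\<^esub>} \<and> b \<in> carrier G - {\<one>\<^bsub>G\<^esub>} \<and> a \<noteq> b
                            \<and> generate G {a} \<inter> generate G {b} \<noteq> {\<one>\<^bsub>G\<^esub>}}\<rparr>"

lemma simple_graph_generalized_power_graph: "simple_graph (generalized_power_graph G)"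
  by (auto simp: simple_graph_def generalized_power_graph_def)

lemma generalized_power_graph_adjacent_iff:
  assumes "a \<in> vertices (generalized_power_graph G)" "b \<in> vertices (generalized_power_graph G)"
    and "a \<noteq> b"
  shows "{a, b} \<in> edges (generalized_power_graph G) \<longleftrightarrow>
           generate G {a} \<inter> generate G {b} \<noteq> {\<one>\<^bsub>G\<^esub>}"
  using assms by (auto simp: generalized_power_graph_def doubleton_eq_iff)

definition torsion_free :: "('a, 'b) monoid_scheme \<Rightarrow> bool" where
  "torsion_free G \<longleftrightarrow>
     (\<forall>x \<in> carrier G. \<forall>n::nat. n > 0 \<longrightarrow> x [^]\<^bsub>G\<^esub> n = \<one>\<^bsub>G\<^esub> \<longrightarrow> x = \<one>\<^bsub>G\<^esub>)"

definition rat_group :: "rat monoid" where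
  "rat_group = \<lparr>carrier = UNIV, monoid.mult = (+), one = 0\<rparr>"

lemma comm_group_rat_group: "comm_group rat_group"
proof (rule comm_groupI)
  show "\<exists>y \<in> carrier rat_group. y \<otimes>\<^bsub>rat_group\<^esub> x = \<one>\<^bsub>rat_group\<^esub>" for x
    by (rule bexI[of _ "- x"]) (auto simp: rat_group_def)
qed (auto simp: rat_group_def)

end

theory Submission
  imports Defs
begin

text \<open>Completeness says that any two non-identity elements have a common non-trivial power. Fixing
  \<open>g \<noteq> \<one>\<close>, every \<open>x\<close> thus satisfies \<open>x\<^sup>n = g\<^sup>m\<close> with \<open>n \<noteq> 0\<close>, and \<open>x \<mapsto> m / n\<close> is a well-defined
  injective homomorphism to the rationals because \<open>g\<close> has infinite order. Conversely, any two
  non-zero rationals have a common non-zero integer multiple.\<close>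

lemma rat_group_simps [simp]:
  "carrier rat_group = UNIV" "x \<otimes>\<^bsub>rat_group\<^esub> y = x + y" "\<one>\<^bsub>rat_group\<^esub> = 0"
  by (simp_all add: rat_group_def)

lemma group_rat_group: "group rat_group"
  using comm_group_rat_group by (rule comm_group.axioms)

lemma rat_group_nat_pow: "x [^]\<^bsub>rat_group\<^esub> (n::nat) = of_nat n * x"
  by (induction n) (simp_all add: algebra_simps)

lemma rat_group_int_pow: "x [^]\<^bsub>rat_group\<^esub> (n::int) = of_int n * x"
proof -
  interpret R: group rat_group by (rule group_rat_group)
  have inv: "inv\<^bsub>rat_group\<^esub> y = - y" for y
    by (rule R.inv_equality) simp_all
  show ?thesis
    by (simp add: int_pow_def2 rat_group_nat_pow inv)
qed

text \<open>\<open>torsion_free\<close> speaks of natural exponents only. A negative power is the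
  inverse of a natural one, so splitting on the sign of \<open>n\<close> extends it to the integer
  exponents used below.\<close>

lemma (in group) torsion_free_int_pow_eq_one_iff:
  assumes "torsion_free G" "x \<in> carrier G"
  shows "x [^] (n::int) = \<one> \<longleftrightarrow> n = 0 \<or> x = \<one>"
proof
  assume eq: "x [^] n = \<one>"
  have nat: "k = 0 \<or> x = \<one>" if "x [^] k = \<one>" for k :: nat
    using assms that unfolding torsion_free_def by blast
  show "n = 0 \<or> x = \<one>"
  proof (cases n rule: int_cases2)
    case (nonneg k)
    with eq nat[of k] show ?thesis
      by (simp add: int_pow_int)
  next
    case (nonpos k)
    with eq assms(2) nat[of k] show ?thesis
      by (simp add: int_pow_neg int_pow_int)
  qed
next
  assume "n = 0 \<or> x = \<one>"
  then show "x [^] n = \<one>"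
    by (elim disjE) simp_all
qed

lemma (in group) torsion_free_int_pow_inject:
  assumes "torsion_free G" "x \<in> carrier G" "x \<noteq> \<one>" "x [^] (m::int) = x [^] n"
  shows "m = n"
proof -
  have "x [^] (m - n) = \<one>"
    using assms(2,4) by (simp add: int_pow_diff)
  then show ?thesis
    using assms(3) by (simp add: torsion_free_int_pow_eq_one_iff[OF assms(1,2)])
qed

text \<open>The subgroup generated by one element consists of its integer powers, and both subgroups
  contain the identity, so only an element other than \<open>\<one>\<close> can make the
  intersection differ from \<open>{\<one>}\<close>.\<close>

lemma (in group) generate_Int_generate_nontrivial_iff:
  assumes "a \<in> carrier G" "b \<in> carrier G"
  shows "generate G {a} \<inter> generate G {b} \<noteq> {\<one>} \<longleftrightarrow>
           (\<exists>(m::int) (n::int). a [^] m = b [^] n \<and> a [^] m \<noteq> \<one>)"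
proof -
  have "\<one> \<in> generate G {a} \<inter> generate G {b}"
    by (simp add: generate.one)
  then have "generate G {a} \<inter> generate G {b} \<noteq> {\<one>} \<longleftrightarrow>
      (\<exists>y \<in> generate G {a} \<inter> generate G {b}. y \<noteq> \<one>)"
    by blast
  also have "\<dots> \<longleftrightarrow> (\<exists>(m::int) (n::int). a [^] m = b [^] n \<and> a [^] m \<noteq> \<one>)"
    using assms by (simp add: generate_pow) blast
  finally show ?thesis .
qed

lemma (in group) complete_generalized_power_graph_iff:
  "complete_graph (generalized_power_graph G) \<longleftrightarrow>
     (\<forall>a \<in> carrier G - {\<one>}. \<forall>b \<in> carrier G - {\<one>}. \<exists>(m::int) (n::int). a [^] m = b [^] n \<and> a [^] m \<noteq> \<one>)"
proof -
  have V: "vertices (generalized_power_graph G) = carrier G - {\<one>}"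
    by (simp add: generalized_power_graph_def)
  have adj: "(a \<noteq> b \<longrightarrow> {a, b} \<in> edges (generalized_power_graph G)) \<longleftrightarrow>
      (\<exists>(m::int) (n::int). a [^] m = b [^] n \<and> a [^] m \<noteq> \<one>)"
    if "a \<in> carrier G - {\<one>}" "b \<in> carrier G - {\<one>}" for a b
  proof (cases "a = b")
    \<comment> \<open>The graph has no loops, but the condition on powers holds on the diagonal
      anyway, with both exponents 1. This lets the characterization drop
      \<open>a \<noteq> b\<close>.\<close>
    case True
    have "\<exists>(m::int) (n::int). a [^] m = a [^] n \<and> a [^] m \<noteq> \<one>"
      using that by (intro exI[of _ 1]) simp
    with True show ?thesis by simp
  next
    case False
    then show ?thesis
      using that generalized_power_graph_adjacent_iff[of a G b]
        generate_Int_generate_nontrivial_iff[of a b] by (simp add: V)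
  qed
  show ?thesis
    by (simp only: complete_graph_def V simple_graph_generalized_power_graph adj simp_thms
        cong: ball_cong)
qed

lemma rat_common_int_multiple:
  fixes p q :: rat
  assumes "p \<noteq> 0" "q \<noteq> 0"
  obtains m n :: int where "of_int m * p = of_int n * q" "of_int m * p \<noteq> 0"
proof -
  obtain a b where p: "p = of_int a / of_int b" "b > 0"
    by (metis quotient_of_div quotient_of_denom_pos surj_pair)
  obtain c d where q: "q = of_int c / of_int d" "d > 0"
    by (metis quotient_of_div quotient_of_denom_pos surj_pair)
  show thesis
    \<comment> \<open>With p = a/b and q = c/d, both multiples equal the product a * c of the
      numerators, which is non-zero.\<close>
    by (rule that[of "b * c" "d * a"]) (use p q assms in auto)
qed

text \<open>\<open>h\<close> turns powers into integer multiples, so a common non-zero multiple of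
  \<open>h a\<close> and \<open>h b\<close> pulls back along the injection to a common non-trivial
  power.\<close>

lemma (in group) common_power_if_inj_hom_rat:
  assumes h: "h \<in> hom G rat_group" and inj: "inj_on h (carrier G)"
    and a: "a \<in> carrier G - {\<one>}" and b: "b \<in> carrier G - {\<one>}"
  obtains m n :: int where "a [^] m = b [^] n" "a [^] m \<noteq> \<one>"
proof -
  interpret h: group_hom G rat_group h
    using h by (simp add: group_hom_def group_hom_axioms_def group_rat_group)
  have pow: "h (x [^] k) = of_int k * h x" if "x \<in> carrier G" for x and k :: int
    using that by (simp add: h.hom_int_pow rat_group_int_pow)
  have "h a \<noteq> 0" "h b \<noteq> 0"
    using a b inj h.inj_on_one_iff by auto
  then obtain m n :: int where mn: "of_int m * h a = of_int n * h b" "of_int m * h a \<noteq> 0"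
    by (rule rat_common_int_multiple)
  have "h (a [^] m) = h (b [^] n)" "h (a [^] m) \<noteq> 0"
    using mn a b by (simp_all add: pow)
  then have "a [^] m = b [^] n" "a [^] m \<noteq> \<one>"
    using a b inj h.hom_one by (auto dest: inj_onD)
  then show thesis by (rule that)
qed

lemma (in comm_group) inj_hom_rat_if_common_powers:
  assumes tf: "torsion_free G" and g: "g \<in> carrier G" "g \<noteq> \<one>"
    and ex: "\<And>x. x \<in> carrier G \<Longrightarrow> \<exists>(m::int) (n::int). n \<noteq> 0 \<and> x [^] n = g [^] m"
  obtains f where "f \<in> hom G rat_group" "inj_on f (carrier G)"
proof -
  obtain M N :: "'a \<Rightarrow> int" where
    N: "\<And>x. x \<in> carrier G \<Longrightarrow> N x \<noteq> 0" and
    MN: "\<And>x. x \<in> carrier G \<Longrightarrow> x [^] N x = g [^] M x"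
    using ex by metis
  define f where "f x = (of_int (M x) / of_int (N x) :: rat)" for x
  \<comment> \<open>Any admissible pair of exponents computes \<open>f x\<close>. The homomorphism
    property needs this, since the exponents found there for \<open>x \<otimes> y\<close> need not
    be the chosen \<open>N (x \<otimes> y)\<close> and \<open>M (x \<otimes> y)\<close>.\<close>
  have f_eq: "f x = of_int m / of_int n"
    if x: "x \<in> carrier G" and n: "n \<noteq> 0" and eq: "x [^] n = g [^] m" for x and m n :: int
  proof -
    \<comment> \<open>Computing \<open>x [^] (N x * n)\<close> in two ways gives two powers of
      \<open>g\<close>; their exponents agree because \<open>g\<close> has infinite order.\<close>
    have "g [^] (M x * n) = (x [^] N x) [^] n"
      by (simp add: MN x g int_pow_pow)
    also have "\<dots> = (x [^] n) [^] N x"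
      by (simp add: x int_pow_pow mult.commute)
    also have "\<dots> = g [^] (m * N x)"
      by (simp add: eq g int_pow_pow)
    finally have "M x * n = m * N x"
      using torsion_free_int_pow_inject tf g by blast
    then have "(of_int (M x) * of_int n :: rat) = of_int m * of_int (N x)"
      by (metis of_int_mult)
    then show ?thesis
      using n N[OF x] by (simp add: f_def frac_eq_eq)
  qed
  have hom: "f \<in> hom G rat_group"
  proof (rule homI)
    fix x y assume x: "x \<in> carrier G" and y: "y \<in> carrier G"
    \<comment> \<open>Commutativity distributes the power over the product; \<open>N x * N y\<close>
      serves as a common denominator.\<close>
    have "(x \<otimes> y) [^] (N x * N y) = (x [^] N x) [^] N y \<otimes> (y [^] N y) [^] N x"
      by (simp add: x y int_pow_distrib int_pow_pow mult.commute)
    also have "\<dots> = g [^] (M x * N y + M y * N x)"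
      by (simp add: MN x y g int_pow_pow int_pow_mult)
    finally have "f (x \<otimes> y) = of_int (M x * N y + M y * N x) / of_int (N x * N y)"
      using x y N by (intro f_eq) auto
    then show "f (x \<otimes> y) = f x \<otimes>\<^bsub>rat_group\<^esub> f y"
      using N[OF x] N[OF y] by (simp add: f_def add_frac_eq)
  qed simp
  interpret f: group_hom G rat_group f
    using hom by (simp add: group_hom_def group_hom_axioms_def group_rat_group)
  have "inj_on f (carrier G)"
  proof (subst f.inj_on_one_iff, intro allI impI)
    \<comment> \<open>A zero value of \<open>f\<close> forces \<open>M x = 0\<close>, so
      \<open>x\<close> has a trivial power with non-zero exponent.\<close>
    fix x assume x: "x \<in> carrier G" and "f x = \<one>\<^bsub>rat_group\<^esub>"
    then have "x [^] N x = \<one>"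
      using N[OF x] MN[OF x] by (simp add: f_def)
    then show "x = \<one>"
      using N[OF x] x tf torsion_free_int_pow_eq_one_iff by blast
  qed
  with hom show thesis by (rule that)
qed

text \<open>The image of an embedding serves as \<open>H\<close>. Both directions of the theorem can
  then work with injective homomorphisms into the rationals.\<close>

lemma (in group) iso_rat_subgroup_iff:
  "(\<exists>H. subgroup H rat_group \<and> G \<cong> rat_group\<lparr>carrier := H\<rparr>) \<longleftrightarrow>
     (\<exists>f \<in> hom G rat_group. inj_on f (carrier G))"
proof
  assume "\<exists>H. subgroup H rat_group \<and> G \<cong> rat_group\<lparr>carrier := H\<rparr>"
  then obtain H h where h: "h \<in> iso G (rat_group\<lparr>carrier := H\<rparr>)"
    by (auto simp: is_iso_def)
  show "\<exists>f \<in> hom G rat_group. inj_on f (carrier G)"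
    by (rule bexI[of _ h]) (use h in \<open>auto simp: iso_def hom_def bij_betw_def\<close>)
next
  assume "\<exists>f \<in> hom G rat_group. inj_on f (carrier G)"
  then obtain f where f: "f \<in> hom G rat_group" "inj_on f (carrier G)" by blast
  interpret f: group_hom G rat_group f
    using f by (simp add: group_hom_def group_hom_axioms_def group_rat_group)
  have "f \<in> iso G (rat_group\<lparr>carrier := f ` carrier G\<rparr>)"
    using f by (auto simp: iso_def hom_def bij_betw_def)
  then show "\<exists>H. subgroup H rat_group \<and> G \<cong> rat_group\<lparr>carrier := H\<rparr>"
    using f.img_is_subgroup by (auto simp: is_iso_def)
qed

theorem theorem2p3:
  fixes G :: "('a, 'b) monoid_scheme"
  assumes "comm_group G"
    and "torsion_free G"
  shows "complete_graph (generalized_power_graph G) \<longleftrightarrow>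
           (\<exists>H. subgroup H rat_group \<and> G \<cong> rat_group\<lparr>carrier := H\<rparr>)"
proof -
  interpret comm_group G by fact
  have "complete_graph (generalized_power_graph G) \<longleftrightarrow>
      (\<exists>f \<in> hom G rat_group. inj_on f (carrier G))"
  proof
    assume complete: "complete_graph (generalized_power_graph G)"
    show "\<exists>f \<in> hom G rat_group. inj_on f (carrier G)"
    \<comment> \<open>The trivial group offers no base element \<open>g\<close>; there the zero map
      is the embedding.\<close>
    proof (cases "carrier G = {\<one>\<^bsub>G\<^esub>}")
      case True
      then show ?thesis
        by (intro bexI[of _ "\<lambda>_. 0"]) (auto simp: hom_def)
    next
      case False
      then obtain g where g: "g \<in> carrier G" "g \<noteq> \<one>\<^bsub>G\<^esub>"
        using one_closed by blast
      have "\<exists>(m::int) (n::int). n \<noteq> 0 \<and> x [^]\<^bsub>G\<^esub> n = g [^]\<^bsub>G\<^esub> m" if x: "x \<in> carrier G" for x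
      proof (cases "x = \<one>\<^bsub>G\<^esub>")
        case True
        \<comment> \<open>The identity is not a vertex, so completeness says nothing about it; its
          fraction is 0/1.\<close>
        then show ?thesis by (intro exI[of _ 0] exI[of _ 1]) simp
      next
        case False
        then obtain n m :: int where nm: "x [^]\<^bsub>G\<^esub> n = g [^]\<^bsub>G\<^esub> m" "x [^]\<^bsub>G\<^esub> n \<noteq> \<one>\<^bsub>G\<^esub>"
          using complete x g unfolding complete_generalized_power_graph_iff by blast
        \<comment> \<open>Non-triviality of the common power is what rules out a zero
          denominator.\<close>
        then have "n \<noteq> 0" by auto
        with nm show ?thesis by blast
      qed
      with assms(2) g show ?thesis
        by (metis inj_hom_rat_if_common_powers)
    qed
  next
    assume "\<exists>f \<in> hom G rat_group. inj_on f (carrier G)"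
    then show "complete_graph (generalized_power_graph G)"
      unfolding complete_generalized_power_graph_iff by (metis common_power_if_inj_hom_rat)
  qed
  then show ?thesis
    by (simp only: iso_rat_subgroup_iff)
qed

end
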